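(* (Local cover theorem) Let $U$ be a left or middle $i$-piece in the bottom-left packing of the subinstance $\mathcal{I}_i$ consisting of the first $i$ squares. Then $U$ can be covered by at most four copies of the squares that are adjacent to $U$; that is, there is a family of translates of squares adjacent to $U$, in which each such square is used at most four times, whose union contains $U$.
   Context: Consider an instance of the Square Strip Packing Problem with strip width $W$ and an ordering $S_1,\dots,S_n$ with its bottom-left packing (each square in turn is placed, without overlapping interiors and inside $[0,W]\times[0,\infty)$, at the feasible position $(x,y)$ with $(y,x)$ lexicographically minimal). Squares are closed sets. $\mathcal{I}_i$ is the subinstance consisting of $S_1,\dots,S_i$ (whose bottom-left packing coincides with the first $i$ placements). $i$-pieces: inductively for $i=1,\dots,n$, the $i$-pieces are the bounded connected components of $([0,W]\times[0,\infty))\setminus\big(\bigcup_{j\le i}S_j\cup\bigcup\{\text{$k$-pieces},\,k<i\}\big)$. A square $S$ is adjacent to a piece $U$ if $\overline U\cap S\ne\varnothing$. A piece is a left piece if it is adjacent to the left strip boundary $\{0\}\times\mathbb{R}_{\ge0}$ (i.e., its closure meets it), a right piece if adjacent to the right strip boundary $\{W\}\times\mathbb{R}_{\ge0}$, and a middle piece otherwise. *)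

theory Defs
  imports "HOL-Analysis.Analysis"
begin

text \<open>Squares are indexed 1..n; a k is the side length of S_k and p k its
  bottom-left corner (x,y).\<close>

definition square_at :: "real \<Rightarrow> real \<times> real \<Rightarrow> (real \<times> real) set" where
  "square_at s q = {fst q .. fst q + s} \<times> {snd q .. snd q + s}"

definition strip :: "real \<Rightarrow> (real \<times> real) set" where
  "strip W = {0..W} \<times> {0..}"

definition feasible_pos ::
  "real \<Rightarrow> (nat \<Rightarrow> real) \<Rightarrow> (nat \<Rightarrow> real \<times> real) \<Rightarrow> nat \<Rightarrow> real \<times> real \<Rightarrow> bool" where
  "feasible_pos W a p k q \<longleftrightarrow>
     square_at (a k) q \<subseteq> strip W \<and>
     (\<forall>j\<in>{1..<k}. interior (square_at (a k) q) \<inter> interior (square_at (a j) (p j)) = {})"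

definition is_BL_packing ::
  "real \<Rightarrow> nat \<Rightarrow> (nat \<Rightarrow> real) \<Rightarrow> (nat \<Rightarrow> real \<times> real) \<Rightarrow> bool" where
  "is_BL_packing W n a p \<longleftrightarrow>
     (\<forall>k\<in>{1..n}. feasible_pos W a p k (p k) \<and>
        (\<forall>q. feasible_pos W a p k q \<longrightarrow>
              snd (p k) < snd q \<or> (snd (p k) = snd q \<and> fst (p k) \<le> fst q)))"

definition pieces_step ::
  "real \<Rightarrow> (nat \<Rightarrow> real) \<Rightarrow> (nat \<Rightarrow> real \<times> real) \<Rightarrow> nat \<Rightarrow> (real \<times> real) set set
     \<Rightarrow> (real \<times> real) set set" where
  "pieces_step W a p i Prev =
     {U \<in> components (strip W - (\<Union>j\<in>{1..i}. square_at (a j) (p j)) - \<Union>Prev). bounded U}"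

primrec pieces_before ::
  "real \<Rightarrow> (nat \<Rightarrow> real) \<Rightarrow> (nat \<Rightarrow> real \<times> real) \<Rightarrow> nat \<Rightarrow> (real \<times> real) set set" where
  "pieces_before W a p 0 = {}"
| "pieces_before W a p (Suc i) =
     pieces_before W a p i \<union>
     (if i = 0 then {} else pieces_step W a p i (pieces_before W a p i))"

definition pieces ::
  "real \<Rightarrow> (nat \<Rightarrow> real) \<Rightarrow> (nat \<Rightarrow> real \<times> real) \<Rightarrow> nat \<Rightarrow> (real \<times> real) set set" where
  "pieces W a p i = pieces_step W a p i (pieces_before W a p i)"

definition adjacent :: "(real \<times> real) set \<Rightarrow> (real \<times> real) set \<Rightarrow> bool" where
  "adjacent S U \<longleftrightarrow> closure U \<inter> S \<noteq> {}"

definition left_piece :: "(real \<times> real) set \<Rightarrow> bool" where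
  "left_piece U \<longleftrightarrow> closure U \<inter> ({0} \<times> {0..}) \<noteq> {}"

definition right_piece :: "real \<Rightarrow> (real \<times> real) set \<Rightarrow> bool" where
  "right_piece W U \<longleftrightarrow> closure U \<inter> ({W} \<times> {0..}) \<noteq> {}"

definition middle_piece :: "real \<Rightarrow> (real \<times> real) set \<Rightarrow> bool" where
  "middle_piece W U \<longleftrightarrow> \<not> left_piece U \<and> \<not> right_piece W U"

end

theory Submission
  imports Defs
begin

text \<open>Every square touches the floor or the top of an earlier square, and the left wall or the right
  side of an earlier square.  Following these neighbours yields a bottom chain and a left chain.
  The region below the left chain and left of the bottom chain of \<open>S\<^sub>k\<close> is closed off as soon as
  \<open>S\<^sub>k\<close> is placed, so it does not meet the \<open>i\<close>-piece \<open>U\<close> if \<open>k < i\<close>.  Hence if \<open>S\<^sub>k\<close> lies to the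
  right of a vertical segment above a point \<open>(u, v)\<close> of \<open>U\<close>, its left chain passes below \<open>(u, v)\<close>,
  which gives \<open>y\<^sub>k - v < x\<^sub>k - u\<close>.

  Let \<open>S\<^sub>c\<close> be the first square above \<open>(u, v)\<close>.  If its distance is at most \<open>2 a\<^sub>c\<close>, one of the
  shifts of \<open>S\<^sub>c\<close> by \<open>(0, -a\<^sub>c)\<close> and \<open>(0, -2 a\<^sub>c)\<close> covers the point.  Otherwise, as \<open>S\<^sub>c\<close> could not be
  placed slightly lower, there is an \<open>S\<^sub>R\<close> with \<open>R < c\<close>, \<open>u < x\<^sub>R < u + a\<^sub>c\<close> and top at height at
  least \<open>y\<^sub>c > v + 2 a\<^sub>c\<close> (or the right wall plays this role, which makes \<open>U\<close> a right piece).  Then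
  \<open>y\<^sub>R < v + a\<^sub>c\<close>, so \<open>a\<^sub>R > a\<^sub>c\<close>, and one of the shifts of \<open>S\<^sub>R\<close> by \<open>(-a\<^sub>R, 0)\<close> and
  \<open>(-a\<^sub>R, -a\<^sub>R)\<close> covers the point.\<close>

subsection \<open>Chains of neighbouring squares\<close>

text \<open>\<open>L\<close> and \<open>R\<close> are the two sides of the bottom chain of square \<open>k\<close>, up to the height of its top.
  Exchanging \<open>x\<close> and \<open>y\<close> gives the two sides of the left chain.\<close>

definition chain_split :: "(nat \<Rightarrow> real) \<Rightarrow> (nat \<Rightarrow> real) \<Rightarrow> (nat \<Rightarrow> real) \<Rightarrow> nat \<Rightarrow>
    (real \<times> real) set \<Rightarrow> (real \<times> real) set \<Rightarrow> bool" where
  "chain_split x y a k L R \<longleftrightarrow> open L \<and> open R \<and> L \<inter> R = {} \<and>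
    (\<forall>u v. 0 \<le> v \<longrightarrow> v < y k + a k \<longrightarrow>
       (\<forall>j\<in>{1..k}. \<not> (x j \<le> u \<and> u \<le> x j + a j \<and> y j \<le> v \<and> v \<le> y j + a j)) \<longrightarrow>
       (u, v) \<in> L \<union> R) \<and>
    (\<forall>u v. (u, v) \<in> L \<union> R \<longrightarrow> v < y k + a k) \<and>
    (\<forall>u v. (u, v) \<in> L \<longrightarrow> y k \<le> v \<longrightarrow> u < x k) \<and>
    (\<forall>u v. (u, v) \<in> R \<longrightarrow> y k \<le> v \<longrightarrow> x k + a k < u) \<and>
    (\<forall>u v. (u, v) \<in> L \<longrightarrow> (\<exists>j\<in>{1..k}. u < x j)) \<and>
    (\<forall>u v. (u, v) \<in> R \<longrightarrow> (\<exists>j\<in>{1..k}. x j + a j < u)) \<and>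
    (\<forall>u v. (u, v) \<in> R \<longrightarrow> v < y k \<longrightarrow> x k - u < y k - v) \<and>
    {..<x k} \<times> {y k<..<y k + a k} \<subseteq> L \<and> {x k + a k<..} \<times> {y k<..<y k + a k} \<subseteq> R"

lemma chain_splitD:
  assumes "chain_split x y a k L R"
  shows "open L" "open R" "L \<inter> R = {}"
    "0 \<le> v \<Longrightarrow> v < y k + a k \<Longrightarrow>
       \<forall>j\<in>{1..k}. \<not> (x j \<le> u \<and> u \<le> x j + a j \<and> y j \<le> v \<and> v \<le> y j + a j) \<Longrightarrow>
       (u, v) \<in> L \<union> R"
    "(u, v) \<in> L \<Longrightarrow> v < y k + a k"
    "(u, v) \<in> R \<Longrightarrow> v < y k + a k"
    "(u, v) \<in> L \<Longrightarrow> y k \<le> v \<Longrightarrow> u < x k"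
    "(u, v) \<in> R \<Longrightarrow> y k \<le> v \<Longrightarrow> x k + a k < u"
    "(u, v) \<in> L \<Longrightarrow> \<exists>j\<in>{1..k}. u < x j"
    "(u, v) \<in> R \<Longrightarrow> \<exists>j\<in>{1..k}. x j + a j < u"
    "(u, v) \<in> R \<Longrightarrow> v < y k \<Longrightarrow> x k - u < y k - v"
    "u < x k \<Longrightarrow> y k < v \<Longrightarrow> v < y k + a k \<Longrightarrow> (u, v) \<in> L"
    "x k + a k < u \<Longrightarrow> y k < v \<Longrightarrow> v < y k + a k \<Longrightarrow> (u, v) \<in> R"
  using assms unfolding chain_split_def by (blast, blast, blast, blast, blast, blast, blast,
      blast, blast, blast, blast, auto)

text \<open>Strong induction along the chain: the separation for the neighbour \<open>b\<close> is
  kept below height \<open>y k\<close>, and only the slab beside square \<open>k\<close> is new. The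
  coordinates are abstract so that exchanging \<open>x\<close> and \<open>y\<close> gives the left
  chain.\<close>

lemma chain_separation:
  fixes x y a :: "nat \<Rightarrow> real"
  assumes nbr: "\<And>k. k \<in> {1..n} \<Longrightarrow> y k = 0 \<or>
      (\<exists>b. 1 \<le> b \<and> b < k \<and> y b + a b = y k \<and> x b < x k + a k \<and> x k < x b + a b)"
    and pos: "\<And>k. k \<in> {1..n} \<Longrightarrow> a k > 0"
    and k: "k \<in> {1..n}"
  obtains L R where "chain_split x y a k L R"
proof -
  have "\<exists>L R. chain_split x y a k L R"
    using k
  proof (induction k rule: less_induct)
    case (less k)
    have ak: "a k > 0" using pos less.prems by blast
    show ?case
    proof (cases "y k = 0")
      case True
      have "chain_split x y a k ({..<x k} \<times> {..<y k + a k}) ({x k + a k<..} \<times> {..<y k + a k})"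
        unfolding chain_split_def using True ak less.prems
        by (intro conjI) (force simp: open_Times)+
      then show ?thesis by blast
    next
      case False
      then obtain b where b: "1 \<le> b" "b < k" "y b + a b = y k" "x b < x k + a k" "x k < x b + a b"
        using nbr less.prems by blast
      have ab: "a b > 0" using pos less.prems b by simp
      from b less.IH[of b] less.prems obtain L R where "chain_split x y a b L R" by auto
      note P = chain_splitD[OF this]
      \<comment> \<open>The third set of each union glues old and new part across height
        \<open>y k\<close>, where the first two have no points. A point at that height outside both
        squares is left of both or right of both, because \<open>b\<close> and \<open>k\<close>
        overlap horizontally.\<close>
      define L' where "L' = (L \<inter> UNIV \<times> {..<y k}) \<union> {..<x k} \<times> {y k<..<y k + a k}
        \<union> {..<min (x k) (x b)} \<times> {y b<..<y k + a k}"
      define R' where "R' = (R \<inter> UNIV \<times> {..<y k}) \<union> {x k + a k<..} \<times> {y k<..<y k + a k}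
        \<union> {max (x k + a k) (x b + a b)<..} \<times> {y b<..<y k + a k}"
      have Lb: "\<And>u v. u < x b \<Longrightarrow> y b < v \<Longrightarrow> v < y k \<Longrightarrow> (u,v) \<in> L"
        and Rb: "\<And>u v. x b + a b < u \<Longrightarrow> y b < v \<Longrightarrow> v < y k \<Longrightarrow> (u,v) \<in> R"
        using P(12,13) b(3) by auto
      have Llow: "\<And>u v. v < y k \<Longrightarrow> (u,v) \<in> L' \<longleftrightarrow> (u,v) \<in> L"
        unfolding L'_def using Lb by auto
      have Rlow: "\<And>u v. v < y k \<Longrightarrow> (u,v) \<in> R' \<longleftrightarrow> (u,v) \<in> R"
        unfolding R'_def using Rb by auto
      have Lup: "\<And>u v. v > y k \<Longrightarrow> (u,v) \<in> L' \<longleftrightarrow> u < x k \<and> v < y k + a k"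
        unfolding L'_def using b ab by auto
      have Rup: "\<And>u v. v > y k \<Longrightarrow> (u,v) \<in> R' \<longleftrightarrow> x k + a k < u \<and> v < y k + a k"
        unfolding R'_def using b ab by auto
      have Lmid: "\<And>u. (u,y k) \<in> L' \<longleftrightarrow> u < min (x k) (x b)"
        unfolding L'_def using b ab ak by auto
      have Rmid: "\<And>u. (u,y k) \<in> R' \<longleftrightarrow> max (x k + a k) (x b + a b) < u"
        unfolding R'_def using b ab ak by auto
      have o: "open L'" "open R'"
        unfolding L'_def R'_def using P(1,2) by (auto intro!: open_Un open_Int open_Times)
      have d: "L' \<inter> R' = {}"
      proof -
        have "\<not> ((u,v) \<in> L' \<and> (u,v) \<in> R')" for u v
        proof (cases v "y k" rule: linorder_cases)
          case less then show ?thesis using P(3) Llow Rlow by blast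
        next
          case equal then show ?thesis using Lmid Rmid ak by auto
        next
          case greater then show ?thesis using Lup Rup ak by auto
        qed
        then show ?thesis by auto
      qed
      have cov: "(u, v) \<in> L' \<union> R'" if v: "0 \<le> v" "v < y k + a k"
        and f: "\<forall>j\<in>{1..k}. \<not> (x j \<le> u \<and> u \<le> x j + a j \<and> y j \<le> v \<and> v \<le> y j + a j)" for u v
      proof (cases v "y k" rule: linorder_cases)
        case less
        have "\<forall>j\<in>{1..b}. \<not> (x j \<le> u \<and> u \<le> x j + a j \<and> y j \<le> v \<and> v \<le> y j + a j)"
          using f b by auto
        then have "(u,v) \<in> L \<union> R" using P(4) v less b(3) by metis
        then show ?thesis using Llow Rlow less by blast
      next
        case equal
        have "x b \<in> {..u} \<longrightarrow> x b + a b < u" "x k \<in> {..u} \<longrightarrow> x k + a k < u"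
          using f[rule_format, of b] f[rule_format, of k] b ab ak equal by auto
        then have "u < min (x k) (x b) \<or> max (x k + a k) (x b + a b) < u"
          using b by (simp add: not_le[symmetric]) linarith
        then show ?thesis unfolding equal Un_iff Lmid Rmid .
      next
        case greater
        have "\<not> (x k \<le> u \<and> u \<le> x k + a k \<and> y k \<le> v \<and> v \<le> y k + a k)"
          using f less.prems by auto
        then show ?thesis using greater Lup Rup v by auto
      qed
      have Lt: "v < y k + a k \<and> (y k \<le> v \<longrightarrow> u < x k) \<and> (\<exists>j\<in>{1..k}. u < x j)"
        if "(u,v) \<in> L'" for u v
      proof (cases v "y k" rule: linorder_cases)
        case less
        then have "\<exists>j\<in>{1..b}. u < x j" using P(9) Llow that by blast
        then show ?thesis using less ak b by force
      next
        case equal then show ?thesis using Lmid that ak less.prems by auto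
      next
        case greater then show ?thesis using Lup that less.prems by auto
      qed
      have Rt: "v < y k + a k \<and> (y k \<le> v \<longrightarrow> x k + a k < u) \<and> (\<exists>j\<in>{1..k}. x j + a j < u) \<and>
          (v < y k \<longrightarrow> x k - u < y k - v)"
        if "(u,v) \<in> R'" for u v
      proof (cases v "y k" rule: linorder_cases)
        case less
        then have uvR: "(u,v) \<in> R" using Rlow that by blast
        then have "\<exists>j\<in>{1..b}. x j + a j < u" using P(10) by blast
        \<comment> \<open>Below \<open>y b\<close>, the bound passes from \<open>b\<close> to
          \<open>k\<close> by \<open>x k < x b + a b\<close> and \<open>y k = y b + a b\<close>.
          From \<open>y b\<close> on, the point is already to the right of square \<open>b\<close>,
          so the left-hand side is negative.\<close>
        moreover have "x k - u < y k - v"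
        proof (cases "v < y b")
          case True
          then have "x b - u < y b - v" using P(11) uvR by blast
          then show ?thesis using b by linarith
        next
          case False
          then have "x b + a b < u" using P(8) uvR by (meson not_less)
          then show ?thesis using b less by linarith
        qed
        ultimately show ?thesis using less ak b by force
      next
        case equal then show ?thesis using Rmid that ak less.prems by auto
      next
        case greater then show ?thesis using Rup that less.prems by auto
      qed
      have "{..<x k} \<times> {y k<..<y k + a k} \<subseteq> L'" "{x k + a k<..} \<times> {y k<..<y k + a k} \<subseteq> R'"
        unfolding L'_def R'_def by auto
      then have "chain_split x y a k L' R'"
        unfolding chain_split_def using o d cov Lt Rt by (intro conjI allI impI) blast+
      then show ?thesis by blast
    qed
  qed
  then show ?thesis using that by blast
qed

subsection \<open>Bottom-left packings\<close>

lemma square_at_iff: "(u, v) \<in> square_at s q \<longleftrightarrow>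
    fst q \<le> u \<and> u \<le> fst q + s \<and> snd q \<le> v \<and> v \<le> snd q + s"
  by (auto simp: square_at_def)

lemma closed_square_at: "closed (square_at s q)"
  unfolding square_at_def by (intro closed_Times closed_atLeastAtMost)

lemma interior_square_at:
  "interior (square_at s q) = {fst q<..<fst q + s} \<times> {snd q<..<snd q + s}"
  by (simp add: square_at_def interior_Times)

lemma interior_squares_disjoint_iff:
  assumes "0 < s" "0 < t"
  shows "interior (square_at s q) \<inter> interior (square_at t r) = {} \<longleftrightarrow>
    fst q + s \<le> fst r \<or> fst r + t \<le> fst q \<or> snd q + s \<le> snd r \<or> snd r + t \<le> snd q"
proof -
  have *: "{b<..<b + s} \<inter> {c<..<c + t} = {} \<longleftrightarrow> b + s \<le> c \<or> c + t \<le> b" for b c :: real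
  proof -
    have "{b<..<b + s} \<inter> {c<..<c + t} = {max b c<..<min (b + s) (c + t)}" by auto
    then show ?thesis using assms by auto
  qed
  show ?thesis
    by (simp only: interior_square_at Times_Int_Times Times_empty * disj_assoc)
qed

locale bl_packing =
  fixes W :: real and n :: nat and a :: "nat \<Rightarrow> real" and p :: "nat \<Rightarrow> real \<times> real"
  assumes W_pos: "W > 0"
    and sides: "\<forall>k\<in>{1..n}. 0 < a k \<and> a k \<le> W"
    and BL: "is_BL_packing W n a p"
begin

abbreviation x where "x k \<equiv> fst (p k)"
abbreviation y where "y k \<equiv> snd (p k)"
abbreviation S where "S k \<equiv> square_at (a k) (p k)"

definition free :: "nat \<Rightarrow> (real \<times> real) set" where
  "free k = strip W - (\<Union>j\<in>{1..k}. S j)"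

lemma a_pos: "k \<in> {1..n} \<Longrightarrow> a k > 0"
  using sides by blast

lemma mem_free: "(u, v) \<in> free k \<longleftrightarrow> 0 \<le> u \<and> u \<le> W \<and> 0 \<le> v \<and>
    (\<forall>j\<in>{1..k}. \<not> (x j \<le> u \<and> u \<le> x j + a j \<and> y j \<le> v \<and> v \<le> y j + a j))"
  by (auto simp: free_def strip_def square_at_iff)

lemma free_antimono: "k \<le> m \<Longrightarrow> free m \<subseteq> free k"
  unfolding free_def by fastforce

lemma square_in_strip:
  assumes "s > 0"
  shows "square_at s q \<subseteq> strip W \<longleftrightarrow> 0 \<le> fst q \<and> fst q + s \<le> W \<and> 0 \<le> snd q"
  using assms unfolding square_at_def strip_def times_subset_iff by auto

lemma feasible_iff:
  assumes "k \<in> {1..n}"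
  shows "feasible_pos W a p k q \<longleftrightarrow> 0 \<le> fst q \<and> fst q + a k \<le> W \<and> 0 \<le> snd q \<and>
    (\<forall>j\<in>{1..<k}. fst q + a k \<le> x j \<or> x j + a j \<le> fst q \<or> snd q + a k \<le> y j \<or> y j + a j \<le> snd q)"
proof -
  have "interior (square_at (a k) q) \<inter> interior (S j) = {} \<longleftrightarrow>
    (fst q + a k \<le> x j \<or> x j + a j \<le> fst q \<or> snd q + a k \<le> y j \<or> y j + a j \<le> snd q)"
    if "j \<in> {1..<k}" for j
    using that assms by (intro interior_squares_disjoint_iff a_pos) auto
  then show ?thesis
    unfolding feasible_pos_def square_in_strip[OF a_pos[OF assms]] by simp
qed

lemma in_strip: "k \<in> {1..n} \<Longrightarrow> 0 \<le> x k \<and> x k + a k \<le> W \<and> 0 \<le> y k"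
  using BL unfolding is_BL_packing_def by (metis feasible_iff)

lemma disjoint_squares:
  assumes "j \<in> {1..n}" "k \<in> {1..n}" "j \<noteq> k"
  shows "x k + a k \<le> x j \<or> x j + a j \<le> x k \<or> y k + a k \<le> y j \<or> y j + a j \<le> y k"
proof -
  have "x k + a k \<le> x j \<or> x j + a j \<le> x k \<or> y k + a k \<le> y j \<or> y j + a j \<le> y k"
    if "j \<in> {1..n}" "k \<in> {1..n}" "j < k" for j k
    using BL that unfolding is_BL_packing_def feasible_iff[OF that(2)]
    by (metis atLeastAtMost_iff atLeastLessThan_iff feasible_iff)
  from this[of j k] this[of k j] show ?thesis using assms by linarith
qed

lemma lowest:
  assumes "k \<in> {1..n}" "0 \<le> u" "u + a k \<le> W" "0 \<le> v" "v < y k \<or> v = y k \<and> u < x k"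
  obtains j where "j \<in> {1..<k}" "x j < u + a k" "u < x j + a j" "y j < v + a k" "v < y j + a j"
proof -
  have "\<not> feasible_pos W a p k (u, v)"
    using BL assms unfolding is_BL_packing_def by fastforce
  then show ?thesis
    using that assms unfolding feasible_iff[OF assms(1)] by (auto simp: not_le)
qed

text \<open>Try to lower square \<open>k\<close> to the highest earlier top under
  \<open>y k\<close>, or to the floor. By the choice of \<open>v\<close>, the blocking square
  reaches at least \<open>y k\<close>; a top equal to \<open>y k\<close> is excluded by assumption,
  and a higher one would make it overlap square \<open>k\<close>.\<close>

lemma bottom_neighbour:
  assumes k: "k \<in> {1..n}"
  shows "y k = 0 \<or> (\<exists>b. 1 \<le> b \<and> b < k \<and> y b + a b = y k \<and> x b < x k + a k \<and> x k < x b + a b)"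
proof (rule ccontr)
  assume H: "\<not> ?thesis"
  define A where "A = insert 0 ((\<lambda>j. y j + a j) ` {j \<in> {1..<k}. y j + a j < y k})"
  have fin: "finite A" and yk: "0 < y k" using H in_strip[OF k] unfolding A_def by auto
  define v where "v = Max A"
  have v: "0 \<le> v" "v < y k" "\<And>j. j \<in> {1..<k} \<Longrightarrow> y j + a j < y k \<Longrightarrow> y j + a j \<le> v"
    unfolding v_def using fin yk by (auto simp: A_def)
  obtain j where j: "j \<in> {1..<k}" "x j < x k + a k" "x k < x j + a j" "y j < v + a k" "v < y j + a j"
    using lowest[OF k, of "x k" v] in_strip[OF k] v by blast
  then have "y j + a j \<ge> y k" using v(3) by force
  moreover have "y j + a j \<noteq> y k" using H j by auto
  moreover have "x k + a k \<le> x j \<or> x j + a j \<le> x k \<or> y k + a k \<le> y j \<or> y j + a j \<le> y k"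
    using disjoint_squares[of j k] j k by auto
  ultimately show False using j v by linarith
qed

text \<open>The same argument with a push to the left, which improves the position by the
  tie-breaking rule at equal height.\<close>

lemma left_neighbour:
  assumes k: "k \<in> {1..n}"
  shows "x k = 0 \<or> (\<exists>b. 1 \<le> b \<and> b < k \<and> x b + a b = x k \<and> y b < y k + a k \<and> y k < y b + a b)"
proof (rule ccontr)
  assume H: "\<not> ?thesis"
  define A where "A = insert 0 ((\<lambda>j. x j + a j) ` {j \<in> {1..<k}. x j + a j < x k})"
  have fin: "finite A" and xk: "0 < x k" using H in_strip[OF k] unfolding A_def by auto
  define u where "u = Max A"
  have u: "0 \<le> u" "u < x k" "\<And>j. j \<in> {1..<k} \<Longrightarrow> x j + a j < x k \<Longrightarrow> x j + a j \<le> u"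
    unfolding u_def using fin xk by (auto simp: A_def)
  obtain j where j: "j \<in> {1..<k}" "x j < u + a k" "u < x j + a j" "y j < y k + a k" "y k < y j + a j"
    using lowest[OF k, of u "y k"] in_strip[OF k] u by force
  then have "x j + a j \<ge> x k" using u(3) by force
  moreover have "x j + a j \<noteq> x k" using H j by auto
  moreover have "x k + a k \<le> x j \<or> x j + a j \<le> x k \<or> y k + a k \<le> y j \<or> y j + a j \<le> y k"
    using disjoint_squares[of j k] j k by auto
  ultimately show False using j u by linarith
qed

text \<open>\<open>T\<close> is the region closed off by both chains of \<open>S k\<close>; \<open>A\<close> and \<open>B\<close> are the sides above and below
  the left chain.\<close>

lemma trap:
  assumes k: "k \<in> {1..n}"
  obtains T E A B where "open T" "open E" "T \<inter> E = {}" "free k \<subseteq> T \<union> E" "bounded (T \<inter> strip W)"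
    "open A" "open B" "A \<inter> B = {}"
    "free k \<inter> {..<x k + a k} \<times> UNIV \<subseteq> A \<union> B"
    "E \<inter> {..<x k} \<times> {y k..y k + a k} \<subseteq> A"
    "\<forall>(u, v)\<in>A. u < x k \<longrightarrow> y k - v < x k - u"
proof -
  have ak: "a k > 0" using a_pos k .
  obtain L R where "chain_split x y a k L R"
    using chain_separation[of n y a x k, OF bottom_neighbour a_pos k] .
  note LR = chain_splitD[OF this]
  obtain B' A' where "chain_split y x a k B' A'"
    using chain_separation[of n x a y k, OF left_neighbour a_pos k] .
  note BA = chain_splitD[OF this]
  have swap: "continuous_on UNIV (prod.swap :: real \<times> real \<Rightarrow> _)"
    by (simp add: continuous_on_swap)
  define A B where "A = prod.swap -` A'" and "B = prod.swap -` B'"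
  have mem: "(u, v) \<in> A \<longleftrightarrow> (v, u) \<in> A'" "(u, v) \<in> B \<longleftrightarrow> (v, u) \<in> B'" for u v
    by (simp_all add: A_def B_def)
  have oAB: "open A" "open B"
    unfolding A_def B_def using swap BA(1,2) open_vimage by blast+
  have dAB: "A \<inter> B = {}" using BA(3) unfolding A_def B_def by auto
  have cAB: "(u, v) \<in> A \<union> B" if "(u, v) \<in> free k" "u < x k + a k" for u v
    using BA(4)[of u v] that unfolding mem_free Un_iff mem by blast
  have cLR: "(u, v) \<in> L \<union> R" if "(u, v) \<in> free k" "v < y k + a k" for u v
    using LR(4)[of v u] that unfolding mem_free by blast
  \<comment> \<open>\<open>L\<close> ends at the top of \<open>S k\<close> and \<open>B\<close> at
    its right side. Hence \<open>B\<close> alone decides up and to the left of the corner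
    \<open>p k\<close>, and \<open>L\<close> alone down and to the right of it.\<close>
  define T where "T = L \<inter> B \<union> B \<inter> {..<x k} \<times> {y k<..} \<union> L \<inter> {x k<..} \<times> {..<y k}"
  define E where "E = R \<union> A \<union> {x k<..} \<times> {y k<..}"
  have "open T" "open E"
    unfolding T_def E_def using LR(1,2) oAB by (auto intro!: open_Un open_Int open_Times)
  moreover have "T \<inter> E = {}"
  proof -
    have "\<not> ((u, v) \<in> T \<and> (u, v) \<in> E)" for u v
      using LR(3) dAB LR(5-8)[of u v] BA(5-8)[of v u] ak unfolding T_def E_def mem[symmetric]
      by (auto; force)
    then show ?thesis by auto
  qed
  moreover have "free k \<subseteq> T \<union> E"
  proof (rule subrelI)
    fix u v assume uv: "(u, v) \<in> free k"
    then have "\<not> (x k \<le> u \<and> u \<le> x k + a k \<and> y k \<le> v \<and> v \<le> y k + a k)"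
      using k unfolding mem_free by auto
    then show "(u, v) \<in> T \<union> E"
      using cAB[OF uv] cLR[OF uv] LR(5-8)[of u v] BA(5-8)[of v u] ak
      unfolding T_def E_def mem[symmetric]
      by (cases "u < x k + a k"; cases "v < y k + a k"; cases "u < x k"; cases "v < y k") auto
  qed
  moreover have "bounded (T \<inter> strip W)"
  proof (rule bounded_subset)
    define m where "m = Max (insert (y k + a k) (y ` {1..k}))"
    show "T \<inter> strip W \<subseteq> {0..W} \<times> {0..m}"
    proof (rule subrelI)
      fix u v assume uv: "(u, v) \<in> T \<inter> strip W"
      then have "v < y k + a k \<or> (\<exists>j\<in>{1..k}. v < y j)"
        unfolding T_def using LR(5) BA(9) mem by auto
      then have "v \<le> m" unfolding m_def by (auto simp: Max_ge_iff intro: less_imp_le)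
      then show "(u, v) \<in> {0..W} \<times> {0..m}" using uv by (auto simp: strip_def)
    qed
    show "bounded ({0..W} \<times> {0..m})" by (simp add: bounded_Times)
  qed
  moreover have "E \<inter> {..<x k} \<times> {y k..y k + a k} \<subseteq> A"
    using LR(8) ak unfolding E_def by fastforce
  moreover have "\<forall>(u, v)\<in>A. u < x k \<longrightarrow> y k - v < x k - u"
    using BA(11) mem by blast
  moreover have "free k \<inter> {..<x k + a k} \<times> UNIV \<subseteq> A \<union> B"
    using cAB by auto
  ultimately show ?thesis using that oAB dAB by blast
qed

subsection \<open>Pieces\<close>

lemma pieces_eq:
  "pieces W a p k = {U \<in> components (free k - \<Union>(pieces_before W a p k)). bounded U}"
  by (simp add: pieces_def pieces_step_def free_def)

lemma pieces_before_iff: "P \<in> pieces_before W a p i \<longleftrightarrow> (\<exists>k\<in>{1..<i}. P \<in> pieces W a p k)"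
proof (induction i)
  case (Suc i)
  then show ?case by (cases "i = 0") (auto simp: pieces_def less_Suc_eq)
qed simp

lemma piece_subset_free: "U \<in> pieces W a p k \<Longrightarrow> U \<subseteq> free k"
  unfolding pieces_eq using in_components_subset by fastforce

lemma piece_connected: "U \<in> pieces W a p k \<Longrightarrow> connected U"
  unfolding pieces_eq using in_components_connected by blast

text \<open>An earlier piece meeting \<open>C\<close> would contain all of \<open>C\<close> by
  induction and so meet \<open>U\<close>, which avoids earlier pieces. Removing them thus never cuts
  a component of \<open>free k\<close> apart.\<close>

lemma piece_saturated:
  assumes "U \<in> pieces W a p k" "connected C" "C \<subseteq> free k" "C \<inter> U \<noteq> {}"
  shows "C \<subseteq> U"
  using assms
proof (induction k arbitrary: U rule: less_induct)
  case (less k)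
  have U: "U \<in> components (free k - \<Union>(pieces_before W a p k))"
    using less.prems(1) pieces_eq by auto
  have "C \<inter> P = {}" if P: "P \<in> pieces_before W a p k" for P
  proof (rule ccontr)
    assume CP: "C \<inter> P \<noteq> {}"
    from P obtain m where m: "m < k" "P \<in> pieces W a p m" by (auto simp: pieces_before_iff)
    then have "C \<subseteq> P"
      using less.IH[OF m less.prems(2) _ CP] free_antimono[of m k] less.prems(3) by auto
    then show False
      using in_components_subset[OF U] P less.prems(4) by blast
  qed
  then have "C \<subseteq> free k - \<Union>(pieces_before W a p k)" using less.prems(3) by blast
  then show ?case using components_maximal[OF U less.prems(2)] less.prems(4) by blast
qed

text \<open>\<open>T\<close> and \<open>E\<close> split \<open>free k\<close>, so the component at
  stage \<open>k\<close> of a point in \<open>T\<close> stays in \<open>T\<close> and is bounded. It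
  is then a \<open>k\<close>-piece, removed before the \<open>i\<close>-pieces are formed.\<close>

lemma piece_not_trapped:
  assumes U: "U \<in> pieces W a p i" and k: "k \<in> {1..<i}"
    and T: "open T" "open E" "T \<inter> E = {}" "free k \<subseteq> T \<union> E" "bounded (T \<inter> strip W)"
  shows "U \<inter> T = {}"
proof (rule ccontr)
  assume "U \<inter> T \<noteq> {}"
  then obtain u where u: "u \<in> U" "u \<in> T" by blast
  have dis: "U \<inter> P = {}" if "P \<in> pieces_before W a p i" for P
  proof -
    have "U \<in> components (free i - \<Union>(pieces_before W a p i))" using U pieces_eq by auto
    then show ?thesis using in_components_subset that by blast
  qed
  define G where "G = free k - \<Union>(pieces_before W a p k)"
  have "u \<in> free k" using u piece_subset_free[OF U] free_antimono[of k i] k by auto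
  moreover have "u \<notin> P" if "P \<in> pieces_before W a p k" for P
  proof -
    have "P \<in> pieces_before W a p i" using that k by (force simp: pieces_before_iff)
    then show ?thesis using dis u by blast
  qed
  ultimately have uG: "u \<in> G" unfolding G_def by blast
  define Q where "Q = connected_component_set G u"
  have Q: "Q \<in> components G" "u \<in> Q" "connected Q" "Q \<subseteq> free k"
    unfolding Q_def using uG connected_component_subset[of G u]
    by (auto simp: componentsI G_def)
  then have "E \<inter> Q = {}" using connectedD[of Q T E] T u by blast
  then have "Q \<subseteq> T \<inter> strip W" using Q(4) T(4) unfolding free_def by blast
  then have "bounded Q" using T(5) bounded_subset by blast
  then have "Q \<in> pieces W a p k" using Q(1) unfolding pieces_eq G_def by blast
  then have "Q \<in> pieces_before W a p i" using k pieces_before_iff by blast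
  then show False using dis Q(2) u by blast
qed

section \<open>Vertical segments in a piece: slopes, ceilings and walls\<close>

lemma connected_vertical: "connected ({u} \<times> {s..t::real})" for u :: real
  by (simp add: connected_Times)

text \<open>The left chain of a square \<open>S k\<close> with \<open>k < i\<close> has to pass below \<open>U\<close>, since
  otherwise \<open>U\<close> would have been cut off when \<open>S k\<close> was placed.  As the squares of the chain overlap
  vertically, the chain descends at most as much as it moves to the left.\<close>

lemma slope:
  assumes U: "U \<in> pieces W a p i" "i \<le> n" and k: "k \<in> {1..<i}"
    and uv: "(u, v) \<in> U" "v \<le> t" "{u} \<times> {v..t} \<subseteq> free k"
    and t: "y k \<le> t" "t \<le> y k + a k" "u < x k"
  shows "y k - v < x k - u"
proof -
  have kn: "k \<in> {1..n}" using U k by auto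
  obtain T E A B where TE: "open T" "open E" "T \<inter> E = {}" "free k \<subseteq> T \<union> E" "bounded (T \<inter> strip W)"
    and AB: "open A" "open B" "A \<inter> B = {}"
    and cover: "free k \<inter> {..<x k + a k} \<times> UNIV \<subseteq> A \<union> B"
    and EA: "E \<inter> {..<x k} \<times> {y k..y k + a k} \<subseteq> A"
    and A: "\<forall>(u, v)\<in>A. u < x k \<longrightarrow> y k - v < x k - u"
    using trap[OF kn] .
  let ?C = "{u} \<times> {v..t}"
  have conn: "connected ?C" by (rule connected_vertical)
  have ends: "(u, v) \<in> ?C" "(u, t) \<in> ?C" using uv by auto
  \<comment> \<open>The segment is used twice: upwards it stays in \<open>E\<close>, so its end
    beside \<open>S k\<close> lies in \<open>A\<close>; downwards it stays in \<open>A\<close>,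
    where the slope bound holds.\<close>
  have "(u, v) \<in> E"
    using piece_not_trapped[OF U(1) k TE] uv(1) ends(1) uv(3) TE(4) by blast
  then have "(u, t) \<in> E"
    using connectedD[OF conn TE(1,2)] TE(3,4) uv(3) ends by blast
  then have "(u, t) \<in> A" using EA t by auto
  moreover have "?C \<subseteq> free k \<inter> {..<x k + a k} \<times> UNIV" using uv(3) t(3) a_pos[OF kn] by auto
  then have "?C \<subseteq> A \<union> B" using cover by blast
  ultimately have "(u, v) \<in> A"
    using connectedD[OF conn AB(1,2)] AB(3) ends by blast
  then show ?thesis using A t(3) by auto
qed

text \<open>With no square above the point, the whole vertical ray would belong to \<open>U\<close>,
  against boundedness. Otherwise the square with the lowest bottom leaves the column under it
  free.\<close>

lemma ceiling:
  assumes U: "U \<in> pieces W a p i" and uv: "(u, v) \<in> U"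
  obtains c where "c \<in> {1..i}" "x c \<le> u" "u \<le> x c + a c" "v < y c" "{u} \<times> {v..<y c} \<subseteq> U"
proof -
  define J where "J = {j \<in> {1..i}. x j \<le> u \<and> u \<le> x j + a j \<and> v < y j}"
  have uvf: "(u, v) \<in> free i" using piece_subset_free[OF U] uv by blast
  have free: "(u, t) \<in> free i" if t: "v \<le> t" "\<And>j. j \<in> J \<Longrightarrow> t < y j" for t
  proof -
    have "\<not> (x j \<le> u \<and> u \<le> x j + a j \<and> y j \<le> t \<and> t \<le> y j + a j)" if j: "j \<in> {1..i}" for j
    proof
      assume *: "x j \<le> u \<and> u \<le> x j + a j \<and> y j \<le> t \<and> t \<le> y j + a j"
      then have "j \<notin> J" using t(2)[of j] by auto
      then have "y j \<le> v" using j * unfolding J_def by auto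
      then show False using uvf j * t(1) unfolding mem_free by fastforce
    qed
    then show ?thesis using uvf t(1) unfolding mem_free by auto
  qed
  have "J \<noteq> {}"
  proof
    assume "J = {}"
    then have "{u} \<times> {v..} \<subseteq> free i" using free by auto
    then have "{u} \<times> {v..} \<subseteq> U"
      using piece_saturated[OF U, of "{u} \<times> {v..}"] uv by (auto simp: connected_Times)
    moreover have "bounded U" using U unfolding pieces_eq by blast
    ultimately have "bounded (snd ` ({u} \<times> {v..}))"
      using bounded_subset bounded_snd by blast
    moreover have "snd ` ({u} \<times> {v..}) = {v..}" by force
    ultimately obtain b where "\<And>t. v \<le> t \<Longrightarrow> \<bar>t\<bar> \<le> b" by (auto simp: bounded_iff)
    from this[of "max v (b + 1)"] show False by auto
  qed
  moreover have "finite J" unfolding J_def by simp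
  ultimately obtain c where c: "c \<in> J" "\<And>j. j \<in> J \<Longrightarrow> y c \<le> y j"
    using arg_min_if_finite(1)[of J y] arg_min_least[of J _ y] by blast
  have "{u} \<times> {v..<y c} \<subseteq> free i" using free c(2) by fastforce
  moreover have "(u, v) \<in> {u} \<times> {v..<y c}" using c(1) unfolding J_def by auto
  moreover have "connected ({u} \<times> {v..<y c})" by (simp add: connected_Times)
  ultimately have "{u} \<times> {v..<y c} \<subseteq> U"
    using piece_saturated[OF U] uv by blast
  then show ?thesis using that c(1) unfolding J_def by blast
qed

text \<open>The bottom chain of a highest square above \<open>U\<close> separates \<open>U\<close> from one of the walls.\<close>

lemma not_left_and_right:
  assumes U: "U \<in> pieces W a p i" and i: "i \<in> {1..n}"
  shows "\<not> (left_piece U \<and> right_piece W U)"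
proof (cases "U = {}")
  case True
  then show ?thesis by (simp add: left_piece_def)
next
  case False
  \<comment> \<open>\<open>K\<close> compares heights only: its squares need not lie over
    \<open>U\<close>. All of \<open>U\<close> is below the highest bottom in \<open>K\<close>, hence
    in the range where \<open>chain_split\<close> covers the free points.\<close>
  define K where "K = {c \<in> {1..i}. \<exists>q\<in>U. snd q < y c}"
  have above: "\<exists>c\<in>K. snd q < y c" if "q \<in> U" for q
  proof -
    obtain c where "c \<in> {1..i}" "snd q < y c"
      using ceiling[OF U, of "fst q" "snd q"] \<open>q \<in> U\<close> by auto
    then show ?thesis using that unfolding K_def by blast
  qed
  have K: "finite K" "K \<noteq> {}" using above False by (auto simp: K_def)
  then have "Max (y ` K) \<in> y ` K" by (intro Max_in) auto
  then obtain k where k: "k \<in> K" "Max (y ` K) = y k" by blast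
  have kn: "k \<in> {1..n}" and ki: "k \<le> i" using k(1) i unfolding K_def by auto
  have below: "snd q < y k" if q: "q \<in> U" for q
  proof -
    obtain c where c: "c \<in> K" "snd q < y c" using above[OF q] by blast
    then have "y c \<le> y k" using K(1) unfolding k(2)[symmetric] by simp
    then show ?thesis using c(2) by simp
  qed
  obtain L R where "chain_split x y a k L R"
    using chain_separation[of n y a x k, OF bottom_neighbour a_pos kn] .
  note LR = chain_splitD[OF this]
  have "U \<subseteq> L \<union> R"
  proof (rule subrelI)
    fix u v assume uv: "(u, v) \<in> U"
    then have "(u, v) \<in> free k" using piece_subset_free[OF U] free_antimono[OF ki] by blast
    moreover have "v < y k + a k" using below[OF uv] a_pos[OF kn] by simp
    ultimately show "(u, v) \<in> L \<union> R" using LR(4)[of v u] unfolding mem_free by blast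
  qed
  then have "U \<subseteq> L \<or> U \<subseteq> R"
    using connectedD[OF piece_connected[OF U] LR(1,2)] LR(3) by blast
  then show ?thesis
  proof
    assume UL: "U \<subseteq> L"
    \<comment> \<open>Finitely many squares leave a uniform gap between \<open>U\<close> and the
      wall, which survives taking the closure. In the other case the smallest side length gives the
      gap.\<close>
    define m where "m = Max (x ` {1..k})"
    have "m \<in> x ` {1..k}" unfolding m_def using kn by (intro Max_in) auto
    then have m: "m < W" using in_strip sides kn by force
    have "U \<subseteq> {..m} \<times> UNIV"
    proof (rule subrelI)
      fix u v assume "(u, v) \<in> U"
      then obtain j where "j \<in> {1..k}" "u < x j" using UL LR(9) by blast
      moreover have "x j \<le> m" using \<open>j \<in> {1..k}\<close> unfolding m_def by auto
      ultimately show "(u, v) \<in> {..m} \<times> UNIV" by auto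
    qed
    then have "closure U \<subseteq> {..m} \<times> UNIV" by (rule closure_minimal) (simp add: closed_Times)
    then show ?thesis using m unfolding right_piece_def by fastforce
  next
    assume UR: "U \<subseteq> R"
    define m where "m = Min (a ` {1..k})"
    have "m \<in> a ` {1..k}" unfolding m_def using kn by (intro Min_in) auto
    then have m: "m > 0" using a_pos kn by force
    have "U \<subseteq> {m..} \<times> UNIV"
    proof (rule subrelI)
      fix u v assume "(u, v) \<in> U"
      then obtain j where j: "j \<in> {1..k}" "x j + a j < u" using UR LR(10) by blast
      moreover have "m \<le> a j" using j unfolding m_def by auto
      moreover have "0 \<le> x j" using in_strip[of j] j kn by auto
      ultimately show "(u, v) \<in> {m..} \<times> UNIV" by auto
    qed
    then have "closure U \<subseteq> {m..} \<times> UNIV" by (rule closure_minimal) (simp add: closed_Times)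
    then show ?thesis using m unfolding left_piece_def by fastforce
  qed
qed

text \<open>Unless the wall is too close, \<open>(d, h)\<close> is a position in the strip lower
  than \<open>p c\<close>, so an earlier square blocks it. The choice of \<open>h\<close> and
  \<open>d\<close> forces this square to reach up to \<open>y c\<close> and to start to the right of
  \<open>u\<close>.\<close>

lemma barrier:
  assumes c: "c \<in> {1..n}" "x c < u" "u < x c + a c" "v < y c" "{u} \<times> {v..<y c} \<subseteq> free c"
  obtains (wall) "W < u + a c"
  | (square) R where "R \<in> {1..<c}" "u < x R" "x R < u + a c" "y c \<le> y R + a R"
      "{u} \<times> {v..max v (y R)} \<subseteq> free R"
proof (cases "W < u + a c")
  case False
  \<comment> \<open>By maximality of \<open>h\<close>, and of \<open>d\<close> below, no earlier top
    is strictly between \<open>h\<close> and \<open>y c\<close>, and no earlier right side strictly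
    between \<open>d\<close> and \<open>u\<close>.\<close>
  define H where "H = insert v ((\<lambda>j. y j + a j) ` {j \<in> {1..<c}. y j + a j < y c})"
  define h where "h = Max H"
  have H: "finite H" "H \<noteq> {}" "\<And>z. z \<in> H \<Longrightarrow> z < y c" unfolding H_def using c by auto
  have "h \<in> H" unfolding h_def using H(1,2) by (rule Max_in)
  then have h: "h < y c" by (rule H(3))
  have vh: "v \<le> h" unfolding h_def by (rule Max_ge[OF H(1)]) (simp add: H_def)
  have hj: "y c \<le> y j + a j" if "j \<in> {1..<c}" "h < y j + a j" for j
  proof (rule ccontr)
    assume "\<not> ?thesis"
    then have "y j + a j \<in> H" using that(1) unfolding H_def by auto
    then show False using Max_ge[OF H(1)] that(2) unfolding h_def by force
  qed
  define D where "D = insert 0 ((\<lambda>j. x j + a j) ` {j \<in> {1..<c}. x j + a j < u})"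
  define d where "d = Max D"
  have "(u, v) \<in> free c" using c(4,5) by auto
  then have uv: "0 \<le> u" "u \<le> W" "0 \<le> v" by (auto simp: mem_free)
  have D: "finite D" "D \<noteq> {}" "\<And>z. z \<in> D \<Longrightarrow> z \<le> u" unfolding D_def using uv by auto
  have "d \<in> D" unfolding d_def using D(1,2) by (rule Max_in)
  then have d: "d \<le> u" by (rule D(3))
  have d0: "0 \<le> d" unfolding d_def by (rule Max_ge[OF D(1)]) (simp add: D_def)
  have dj: "u \<le> x j + a j" if "j \<in> {1..<c}" "d < x j + a j" for j
  proof (rule ccontr)
    assume "\<not> ?thesis"
    then have "x j + a j \<in> D" using that(1) unfolding D_def by auto
    then show False using Max_ge[OF D(1)] that(2) unfolding d_def by force
  qed
  \<comment> \<open>Such a square would reach \<open>y c\<close>; starting below \<open>y c\<close>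
    it would meet the free column, and starting higher it would overlap \<open>S c\<close>.\<close>
  have col: "\<not> (x j \<le> u \<and> u \<le> x j + a j \<and> h < y j + a j \<and> y j < y c + a c)"
    if j: "j \<in> {1..<c}" for j
  proof
    assume *: "x j \<le> u \<and> u \<le> x j + a j \<and> h < y j + a j \<and> y j < y c + a c"
    then have "y c \<le> y j + a j" using hj j by blast
    moreover have "y j < y c \<Longrightarrow> False"
    proof -
      assume "y j < y c"
      then have "(u, max v (y j)) \<in> free c" using c by auto
      then show False using j * \<open>y c \<le> y j + a j\<close> c(4) unfolding mem_free by fastforce
    qed
    moreover have "x c + a c \<le> x j \<or> x j + a j \<le> x c \<or> y c + a c \<le> y j \<or> y j + a j \<le> y c"
      using disjoint_squares[of j c] j c(1) by auto
    moreover have "a j > 0" using a_pos j c(1) by auto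
    ultimately show False using * c(2,3) by linarith
  qed
  obtain R where R: "R \<in> {1..<c}" "x R < d + a c" "d < x R + a R" "y R < h + a c" "h < y R + a R"
    using lowest[OF c(1) d0, of h] d h vh uv False by force
  have "u \<le> x R + a R" using dj R by blast
  moreover have "y R < y c + a c" using R(4) h by linarith
  ultimately have "u < x R" using col[OF R(1)] R(5) by linarith
  moreover have "x R < u + a c" using R(2) d by linarith
  moreover have "y c \<le> y R + a R" using hj R by blast
  \<comment> \<open>Above \<open>y c\<close> the segment may run through \<open>S c\<close>, which
    is harmless at the earlier stage \<open>R\<close>; \<open>col\<close> keeps the other squares
    away.\<close>
  moreover have "{u} \<times> {v..max v (y R)} \<subseteq> free R"
  proof (rule subrelI)
    fix u' t assume ut: "(u', t) \<in> {u} \<times> {v..max v (y R)}"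
    show "(u', t) \<in> free R"
    proof (cases "t < y c")
      case True
      then have "(u', t) \<in> free c" using c(5) ut by auto
      then show ?thesis using free_antimono[of R c] R(1) by auto
    next
      case False
      then have t: "y c \<le> t" "t < y c + a c" using ut R(4) h c(4) by auto
      have "\<not> (x j \<le> u \<and> u \<le> x j + a j \<and> y j \<le> t \<and> t \<le> y j + a j)" if "j \<in> {1..R}" for j
        using col[of j] that R(1) h t by force
      then show ?thesis using ut uv unfolding mem_free by auto
    qed
  qed
  ultimately show ?thesis using square R(1) by blast
qed (use wall in blast)

section \<open>Limit points, horizontal visibility and adjacency\<close>

lemma vertical_limit:
  fixes u v w :: real
  assumes "v < w" "{u} \<times> {v..<w} \<subseteq> U"
  shows "(u, w) \<in> closure U"
proof -
  have "closure ({u} \<times> {v..<w}) \<subseteq> closure U" using assms by (intro closure_mono)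
  then show ?thesis using assms by (auto simp: closure_Times)
qed

lemma horizontal_limit:
  fixes t v w :: real
  assumes "v < w" "{v..<w} \<times> {t} \<subseteq> U"
  shows "(w, t) \<in> closure U"
proof -
  have "closure ({v..<w} \<times> {t}) \<subseteq> closure U" using assms by (intro closure_mono)
  then show ?thesis using assms by (auto simp: closure_Times)
qed

text \<open>A square that blocks the view to \<open>X\<close> at height \<open>t\<close> is smaller than \<open>s\<close>.  By \<open>slope\<close> it
  cannot reach the height \<open>v + s\<close> unless it is \<open>S i\<close>, which cannot block both heights.\<close>

lemma visible:
  assumes U: "U \<in> pieces W a p i" "i \<in> {1..n}" and s: "0 < s" "{u} \<times> {v..v + 2 * s} \<subseteq> U"
    and X: "X \<le> W" "X < u + s"
    and narrow: "\<And>j t. j \<in> {1..i} \<Longrightarrow> t \<in> {v + s, v + 2 * s} \<Longrightarrow> y j \<le> t \<Longrightarrow> t \<le> y j + a j \<Longrightarrow>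
      u < x j \<Longrightarrow> x j < X \<Longrightarrow> x j + a j \<le> X"
  obtains t where "t \<in> {v + s, v + 2 * s}" "{u..<X} \<times> {t} \<subseteq> U"
proof -
  have blocker: "j = i" if j: "j \<in> {1..i}" "t \<in> {v + s, v + 2 * s}" "y j \<le> t" "t \<le> y j + a j"
      "u < x j" "x j < X" for j t
  proof (rule ccontr)
    assume "j \<noteq> i"
    then have ji: "j \<in> {1..<i}" using j by auto
    have vt: "v + s \<le> t" "t \<le> v + 2 * s" using j(2) s(1) by auto
    have "{u} \<times> {v..t} \<subseteq> U" using s(2) vt by auto
    moreover have "U \<subseteq> free j"
      using piece_subset_free[OF U(1)] free_antimono[of j i] j(1) by auto
    ultimately have "{u} \<times> {v..t} \<subseteq> free j" by blast
    moreover have "(u, v) \<in> U" "i \<le> n" "v \<le> t" using s U(2) vt by auto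
    ultimately have "y j - v < x j - u"
      using slope[OF U(1) _ ji _ _ _ j(3-5)] by blast
    moreover have "x j + a j \<le> X" using narrow j by blast
    ultimately show False using j(4) vt X by linarith
  qed
  have "\<exists>t\<in>{v + s, v + 2 * s}. \<forall>j\<in>{1..i}. \<not> (y j \<le> t \<and> t \<le> y j + a j \<and> u < x j \<and> x j < X)"
  proof (rule ccontr)
    assume "\<not> ?thesis"
    then have "\<forall>t\<in>{v + s, v + 2 * s}. y i \<le> t \<and> t \<le> y i + a i \<and> u < x i \<and> x i < X"
      using blocker by metis
    moreover from this have "x i + a i \<le> X" using narrow[of i "v + s"] U(2) by auto
    ultimately show False using X by auto
  qed
  then obtain t where t: "t \<in> {v + s, v + 2 * s}"
    "\<And>j. j \<in> {1..i} \<Longrightarrow> \<not> (y j \<le> t \<and> t \<le> y j + a j \<and> u < x j \<and> x j < X)" by blast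
  have utU: "(u, t) \<in> U" using s t(1) by auto
  then have ut: "(u, t) \<in> free i" using piece_subset_free[OF U(1)] by blast
  show ?thesis
  proof (cases "u < X")
    case True
    have "{u..<X} \<times> {t} \<subseteq> free i"
    proof (rule subrelI)
      fix r t' assume r: "(r, t') \<in> {u..<X} \<times> {t}"
      have "\<not> (x j \<le> r \<and> r \<le> x j + a j \<and> y j \<le> t \<and> t \<le> y j + a j)" if j: "j \<in> {1..i}" for j
        using t(2)[OF j] ut j r unfolding mem_free by fastforce
      then show "(r, t') \<in> free i" using ut r X unfolding mem_free by auto
    qed
    moreover have "connected ({u..<X} \<times> {t})" by (simp add: connected_Times)
    moreover have "(u, t) \<in> {u..<X} \<times> {t}" using True by simp
    ultimately have "{u..<X} \<times> {t} \<subseteq> U" using piece_saturated[OF U(1)] utU by blast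
    then show ?thesis using that t(1) by blast
  next
    case False
    then show ?thesis using that t(1) by auto
  qed
qed

text \<open>Adjacency comes from \<open>visible\<close>: a horizontal segment of \<open>U\<close>
  ends at the obstacle, which therefore meets the closure. If the obstacle were the wall,
  \<open>U\<close> would be a right piece, and neither a left nor a middle piece can be one.\<close>

lemma deep_point_covered:
  assumes U: "U \<in> pieces W a p i" "i \<in> {1..n}" "left_piece U \<or> middle_piece W U"
    and c: "c \<in> {1..i}" "x c < u" "u < x c + a c" "{u} \<times> {v..<y c} \<subseteq> U" "v + 2 * a c < y c"
  obtains R where "R \<in> {1..i}" "adjacent (S R) U" "x R - a R \<le> u" "u \<le> x R"
    "y R - a R \<le> v" "v \<le> y R + a R"
proof -
  have cn: "c \<in> {1..n}" using c(1) U(2) by auto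
  have ac: "a c > 0" using a_pos[OF cn] .
  have "{u} \<times> {v..<y c} \<subseteq> free c"
    using c(4) piece_subset_free[OF U(1)] free_antimono[of c i] c(1) by auto
  moreover have "v < y c" using c(5) ac by simp
  ultimately consider (wall) "W < u + a c"
    | (square) R where "R \<in> {1..<c}" "u < x R" "x R < u + a c" "y c \<le> y R + a R"
      "{u} \<times> {v..max v (y R)} \<subseteq> free R"
    using barrier[OF cn c(2,3)] by metis
  note cases = this
  have col: "{u} \<times> {v..v + 2 * a c} \<subseteq> U" using c(4,5) by auto
  have uv: "(u, v) \<in> U" using col ac by auto
  from cases show ?thesis
  proof cases
    case wall
    have "x j + a j \<le> W" if "j \<in> {1..i}" for j using in_strip[of j] that U(2) by auto
    then obtain t where t: "t \<in> {v + a c, v + 2 * a c}" "{u..<W} \<times> {t} \<subseteq> U"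
      using visible[OF U(1,2) ac col order_refl wall] by blast
    have uW: "u < W" using c(3) in_strip[OF cn] by auto
    have "(W, t) \<in> closure U" using horizontal_limit[OF uW t(2)] .
    moreover have "(u, v) \<in> free i" using uv piece_subset_free[OF U(1)] by blast
    then have "0 \<le> t" using t(1) ac by (auto simp: mem_free)
    ultimately have "right_piece W U" unfolding right_piece_def by auto
    then show ?thesis
      using U(3) not_left_and_right[OF U(1,2)] unfolding middle_piece_def by blast
  next
    case R: (square R)
    have Ri: "R \<in> {1..<i}" and Rn: "R \<in> {1..n}" using R(1) c(1) cn by auto
    have aR: "a R > 0" using a_pos[OF Rn] .
    have "y R - v < x R - u"
    proof (rule slope[OF U(1) _ Ri uv _ R(5)])
      show "max v (y R) \<le> y R + a R" using R(4) c(5) ac aR by auto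
    qed (use U(2) R(2) in auto)
    then have yR: "y R < v + a c" "a c < a R" "y R - a R < v" using R(3,4) c(5) by linarith+
    \<comment> \<open>Both test heights lie strictly between bottom and top of \<open>S R\<close>,
      so a square met there that starts to its left must also end there.\<close>
    have "x j + a j \<le> x R" if j: "j \<in> {1..i}" "t \<in> {v + a c, v + 2 * a c}" "y j \<le> t"
      "t \<le> y j + a j" "x j < x R" for j t
    proof -
      have "x R + a R \<le> x j \<or> x j + a j \<le> x R \<or> y R + a R \<le> y j \<or> y j + a j \<le> y R"
        using disjoint_squares[of j R] j Rn U(2) by auto
      moreover have "y R < t" "t < y R + a R" using j(2) yR(1) R(4) c(5) ac by auto
      ultimately show ?thesis using j aR by linarith
    qed
    moreover have "x R \<le> W" using in_strip[OF Rn] aR by linarith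
    ultimately obtain t where t: "t \<in> {v + a c, v + 2 * a c}" "{u..<x R} \<times> {t} \<subseteq> U"
      using visible[OF U(1,2) ac col _ R(3)] by blast
    have "(x R, t) \<in> closure U" using horizontal_limit[OF R(2) t(2)] .
    moreover have "(x R, t) \<in> S R"
      unfolding square_at_iff using t(1) yR(1) R(4) c(5) ac aR by auto
    ultimately have "adjacent (S R) U" unfolding adjacent_def by blast
    then show ?thesis using that[of R] Ri R(2,3,4) yR c(5) ac by auto
  qed
qed

subsection \<open>The cover\<close>

definition shifts :: "nat \<Rightarrow> (real \<times> real) set" where
  "shifts j = {(0, - a j), (0, - 2 * a j), (- a j, 0), (- a j, - a j)}"

definition cover :: "nat \<Rightarrow> (real \<times> real) set \<Rightarrow> (real \<times> real) set" where
  "cover i U = (\<Union>j \<in> {j\<in>{1..i}. adjacent (S j) U}. \<Union>v \<in> shifts j. (\<lambda>x. v + x) ` S j)"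

lemma mem_translate: "(u, v) \<in> (\<lambda>x. (b, d) + x) ` square_at s q \<longleftrightarrow> (u - b, v - d) \<in> square_at s q"
  by (force simp: image_iff)

lemma closed_cover: "closed (cover i U)"
  unfolding cover_def shifts_def
  by (intro closed_UN ballI closed_translation closed_square_at) auto

text \<open>For such \<open>u\<close> the bounds from \<open>ceiling\<close> become strict, which
  \<open>barrier\<close> uses to derive overlaps with \<open>S c\<close>.\<close>

lemma generic_point_covered:
  assumes U: "U \<in> pieces W a p i" "i \<in> {1..n}" "left_piece U \<or> middle_piece W U"
    and uv: "(u, v) \<in> U" and u: "\<And>j. j \<in> {1..i} \<Longrightarrow> u \<noteq> x j \<and> u \<noteq> x j + a j"
  shows "(u, v) \<in> cover i U"
proof -
  obtain c where c: "c \<in> {1..i}" "x c \<le> u" "u \<le> x c + a c" "v < y c" "{u} \<times> {v..<y c} \<subseteq> U"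
    using ceiling[OF U(1) uv] .
  have ac: "a c > 0" using a_pos c(1) U(2) by auto
  show ?thesis
  proof (cases "v + 2 * a c < y c")
    case True
    obtain R where R: "R \<in> {1..i}" "adjacent (S R) U" "x R - a R \<le> u" "u \<le> x R"
      "y R - a R \<le> v" "v \<le> y R + a R"
      using deep_point_covered[OF U c(1) _ _ c(5) True] c(2,3) u[OF c(1)] by force
    have "(u, v) \<in> (\<lambda>x. (- a R, 0) + x) ` S R \<or> (u, v) \<in> (\<lambda>x. (- a R, - a R) + x) ` S R"
      unfolding mem_translate square_at_iff using R by auto
    then show ?thesis unfolding cover_def shifts_def using R(1,2) by blast
  next
    case False
    have "(u, y c) \<in> closure U" using vertical_limit[OF c(4,5)] .
    moreover have "(u, y c) \<in> S c" using c ac by (simp add: square_at_iff)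
    ultimately have "adjacent (S c) U" unfolding adjacent_def by blast
    moreover have "(u, v) \<in> (\<lambda>x. (0, - a c) + x) ` S c \<or> (u, v) \<in> (\<lambda>x. (0, - 2 * a c) + x) ` S c"
      unfolding mem_translate square_at_iff using c False by auto
    ultimately show ?thesis unfolding cover_def shifts_def using c(1) by blast
  qed
qed

lemma piece_covered:
  assumes U: "U \<in> pieces W a p i" "i \<in> {1..n}" "left_piece U \<or> middle_piece W U"
  shows "U \<subseteq> cover i U"
proof (rule ccontr)
  \<comment> \<open>As the cover is closed, a point \<open>(u, v)\<close> outside it can be moved horizontally to one where
    \<open>u\<close> is not the abscissa of a vertical side.\<close>
  assume "\<not> ?thesis"
  then obtain u v where uv: "(u, v) \<in> U" "(u, v) \<notin> cover i U" by auto
  have uvf: "(u, v) \<in> free i" using piece_subset_free[OF U(1)] uv by blast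
  define O1 where "O1 = - cover i U \<inter> - (\<Union>j\<in>{1..i}. S j)"
  have "closed (\<Union>j\<in>{1..i}. S j)" by (intro closed_UN ballI closed_square_at) auto
  then have "open O1" unfolding O1_def using closed_cover by blast
  moreover have "(u, v) \<in> O1" using uv(2) uvf unfolding O1_def free_def by blast
  ultimately obtain e where e: "e > 0" "ball (u, v) e \<subseteq> O1" using open_contains_ball by blast
  have near: "(r, v) \<in> O1" if "\<bar>r - u\<bar> < e" for r
    using e(2) that by (auto simp: dist_Pair_Pair dist_real_def abs_minus_commute subset_iff)
  have "0 \<le> u" "u \<le> W" using uvf by (auto simp: mem_free)
  \<comment> \<open>Clipping keeps the segment in the strip; since \<open>W > 0\<close> it is
    nondegenerate even at a wall. As \<open>O1\<close> avoids the squares too, the segment is free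
    and stays in \<open>U\<close>.\<close>
  define l r where "l = max 0 (u - e / 2)" and "r = min W (u + e / 2)"
  have lr: "l < r" "l \<le> u" "u \<le> r" unfolding l_def r_def using \<open>0 \<le> u\<close> \<open>u \<le> W\<close> e(1) W_pos by auto
  have seg: "(s, v) \<in> O1 \<and> (s, v) \<in> free i" if "s \<in> {l..r}" for s
  proof -
    have "(s, v) \<in> O1" using near that e(1) unfolding l_def r_def by (auto simp: abs_if)
    moreover have "(s, v) \<in> strip W" using that uvf unfolding l_def r_def strip_def mem_free by auto
    ultimately show ?thesis unfolding O1_def free_def by blast
  qed
  have "connected ({l..r} \<times> {v})" by (simp add: connected_Times)
  moreover have "{l..r} \<times> {v} \<subseteq> free i" using seg by auto
  moreover have "(u, v) \<in> {l..r} \<times> {v}" using lr by simp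
  ultimately have "{l..r} \<times> {v} \<subseteq> U" using piece_saturated[OF U(1)] uv(1) by blast
  moreover have "infinite ({l..r} - (\<Union>j\<in>{1..i}. {x j, x j + a j}))"
    using infinite_Icc[OF lr(1)] by simp
  then have "{l..r} - (\<Union>j\<in>{1..i}. {x j, x j + a j}) \<noteq> {}"
    using finite.emptyI by metis
  then obtain s where s: "s \<in> {l..r}" "\<And>j. j \<in> {1..i} \<Longrightarrow> s \<noteq> x j \<and> s \<noteq> x j + a j"
    by blast
  ultimately have "(s, v) \<in> U" by blast
  then have "(s, v) \<in> cover i U" using generic_point_covered[OF U] s(2) by blast
  moreover have "(s, v) \<in> O1" using seg s(1) by blast
  ultimately show False unfolding O1_def by blast
qed

end

theorem theorem9:
  fixes W :: real and n i :: nat and a :: "nat \<Rightarrow> real" and p :: "nat \<Rightarrow> real \<times> real"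
    and U :: "(real \<times> real) set"
  assumes "W > 0"
    and "\<forall>k\<in>{1..n}. 0 < a k \<and> a k \<le> W"
    and "is_BL_packing W n a p"
    and "i \<in> {1..n}"
    and "U \<in> pieces W a p i"
    and "left_piece U \<or> middle_piece W U"
  shows "\<exists>T :: nat \<Rightarrow> (real \<times> real) set.
           (\<forall>j. finite (T j) \<and> card (T j) \<le> 4) \<and>
           U \<subseteq> (\<Union>j \<in> {j\<in>{1..i}. adjacent (square_at (a j) (p j)) U}.
                    \<Union>v \<in> T j. (\<lambda>x. v + x) ` square_at (a j) (p j))"
proof -
  interpret bl_packing W n a p using assms by unfold_locales
  have "card (shifts j) \<le> 4" for j
    by (simp add: shifts_def card_insert_if)
  moreover have "finite (shifts j)" for j by (simp add: shifts_def)
  ultimately show ?thesis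
    using piece_covered[OF assms(5,4,6)] unfolding cover_def by blast
qed

end
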